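(* Let $m\ge2$ and $2\le s\le q$ be integers with $q$ a prime power, let $S_1,\dots,S_m\subseteq\mathbb{F}_q$ each have $s$ elements, and $n=s^m$. Let $\delta\in\{1,\dots,s^m\}$, let $v\in\{0,\dots,m-1\}$ with $s^v\le\delta\le s^{v+1}$, and let $\delta^\perp$ be a positive integer with $\delta^\perp\le\lfloor(s-\frac{\delta}{s^v}+1)s^{m-v-1}\rfloor$. With $L_1=\{N\in\Delta(s,\dots,s)\mid D(N)\ge\delta\}$ and $L_2=\{N\in\Delta(s,\dots,s)\mid D^\perp(N)<\delta^\perp\}$ we have $L_2\subseteq L_1$, and $\ell=\#L_1-\#L_2=\dim C(L_1)-\dim C(L_2)$ satisfies $$\ell\ \ge\ s^m-\sum_{t=1}^m\frac{1}{(t-1)!}\left(\delta\Big(\ln\frac{s^m}{\delta}\Big)^{t-1}+\delta^\perp\Big(\ln\frac{s^m}{\delta^\perp}\Big)^{t-1}\right).$$ If $\ell\ge1$ then $M_1(C(L_1),C(L_2))\ge\delta$ and $M_1(C(L_2)^\perp,C(L_1)^\perp)\ge\delta^\perp$. Equivalently, this yields a linear ramp secret sharing scheme over $\mathbb{F}_q$ with $n=s^m$ participants and secrets in $\mathbb{F}_q^\ell$ with first privacy number $t_1\ge\delta^\perp-1$ and last reconstruction number $r_\ell\le s^m-\delta+1$, and an asymmetric quantum (CSS) code with parameters $[[s^m,\ell,d_z\ge\delta/d_x\ge\delta^\perp]]_q$.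
   Context: $S=S_1\times\cdots\times S_m=\{\alpha_1,\dots,\alpha_n\}$. $\Delta(s,\dots,s)=\{X_1^{i_1}\cdots X_m^{i_m}\mid 0\le i_t<s\}$. For $L\subseteq\Delta(s,\dots,s)$, $C(L)\subseteq\mathbb{F}_q^n$ is the span of $(N(\alpha_1),\dots,N(\alpha_n))$, $N\in L$; $C^\perp$ is the Euclidean dual. For $N=X_1^{i_1}\cdots X_m^{i_m}$: $D(N)=\prod_t(s-i_t)$, $D^\perp(N)=\prod_t(i_t+1)$. For linear codes $C_2\subsetneq C_1$, $M_1(C_1,C_2)=\min\{w_H(\vec c)\mid\vec c\in C_1\setminus C_2\}$. For the ramp scheme $C_1/C_2$ with $\ell=\dim C_1-\dim C_2$ one has $t_1=M_1(C_2^\perp,C_1^\perp)-1$ and $r_\ell=n-M_1(C_1,C_2)+1$; the CSS asymmetric quantum code from $C_2\subset C_1$ has parameters $[[n,\ell,d_z/d_x]]_q$ with $d_z=M_1(C_1,C_2)$, $d_x=M_1(C_2^\perp,C_1^\perp)$. *)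

theory Defs
  imports Complex_Main "HOL-Library.Function_Algebras" "HOL-Library.FuncSet" "HOL-Library.Cardinality"
begin

(* Exponent vectors of monomials X_1^{i_1}...X_m^{i_m}: functions e :: nat => nat,
   coordinate t (0-based, t < m) is the exponent of X_{t+1}; e t = 0 for t >= m. *)
definition Delta :: "nat \<Rightarrow> nat \<Rightarrow> (nat \<Rightarrow> nat) set" where
  "Delta m s = {e. (\<forall>t<m. e t < s) \<and> (\<forall>t\<ge>m. e t = 0)}"

definition Dfun :: "nat \<Rightarrow> nat \<Rightarrow> (nat \<Rightarrow> nat) \<Rightarrow> nat" where
  "Dfun m s e = (\<Prod>t<m. s - e t)"

definition Dperp :: "nat \<Rightarrow> (nat \<Rightarrow> nat) \<Rightarrow> nat" where
  "Dperp m e = (\<Prod>t<m. e t + 1)"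

definition points :: "nat \<Rightarrow> (nat \<Rightarrow> 'a set) \<Rightarrow> (nat \<Rightarrow> 'a) set" where
  "points m S = PiE {..<m} S"

definition evalmon :: "nat \<Rightarrow> (nat \<Rightarrow> nat) \<Rightarrow> (nat \<Rightarrow> 'a::comm_ring_1) \<Rightarrow> 'a" where
  "evalmon m e p = (\<Prod>t<m. p t ^ e t)"

(* Words of F_q^n are functions on the point set P (n = |P| coordinates), zero outside P. *)
definition words :: "'p set \<Rightarrow> ('p \<Rightarrow> 'a::zero) set" where
  "words P = {c. \<forall>p. p \<notin> P \<longrightarrow> c p = 0}"

definition wscale :: "'a::times \<Rightarrow> ('p \<Rightarrow> 'a) \<Rightarrow> ('p \<Rightarrow> 'a)" where
  "wscale c f = (\<lambda>p. c * f p)"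

definition evcode :: "nat \<Rightarrow> (nat \<Rightarrow> 'a set) \<Rightarrow> (nat \<Rightarrow> nat) set \<Rightarrow> ((nat \<Rightarrow> 'a) \<Rightarrow> 'a::field) set" where
  "evcode m S L = {c. \<exists>a. c = (\<lambda>p. if p \<in> points m S then (\<Sum>N\<in>L. a N * evalmon m N p) else 0)}"

definition dualcode :: "'p set \<Rightarrow> ('p \<Rightarrow> 'a::field) set \<Rightarrow> ('p \<Rightarrow> 'a) set" where
  "dualcode P C = {c \<in> words P. \<forall>c'\<in>C. (\<Sum>p\<in>P. c p * c' p) = 0}"

definition hweight :: "'p set \<Rightarrow> ('p \<Rightarrow> 'a::zero) \<Rightarrow> nat" where
  "hweight P c = card {p \<in> P. c p \<noteq> 0}"

definition M1 :: "'p set \<Rightarrow> ('p \<Rightarrow> 'a::zero) set \<Rightarrow> ('p \<Rightarrow> 'a) set \<Rightarrow> nat" where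
  "M1 P C1 C2 = Min (hweight P ` (C1 - C2))"

definition wdim :: "('p \<Rightarrow> 'a::field) set \<Rightarrow> nat" where
  "wdim C = vector_space.dim wscale C"

end

(* Both weight bounds go by induction on the number of variables, slicing the grid along the last
   coordinate. For a polynomial, take the highest power X^j of the last variable with nonzero
   coefficient g: on every line over a non-zero of g it has at least s - j non-zeros. Dually, for a
   word c take the least j whose moment c_j(p) = sum_x c(p, x) x^j is not identically zero: on every
   line over a non-zero of c_j the word c has at least j + 1 non-zeros, as fewer values are
   determined by their first j moments. Hence every nonzero word of C(L_1) has weight at least
   min D(N), and a word outside C(L_1)^perp but in C(L_2)^perp pairs with some N not in L_2 such that
   its weight is at least D^perp(N).
   The numbers of exponents with D(N) < delta or D^perp(N) < delta^perp are numbers of lattice points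
   under a hyperboloid, bounded by the volume of the region. *)

theory Submission
  imports Defs "HOL-Computational_Algebra.Polynomial"
begin

subsection \<open>Splitting off the last coordinate\<close>

text \<open>Exponents vanish from position \<open>m\<close> on, so resetting coordinate
  \<open>m\<close> to \<open>0\<close> recovers the shorter vector.\<close>

lemma bij_betw_Delta_Suc:
  "bij_betw (\<lambda>(N, j). N(m := j)) (Delta m s \<times> {..<s}) (Delta (Suc m) s)"
proof (rule bij_betw_byWitness[where f' = "\<lambda>N. (N(m := 0), N m)"])
  show "\<forall>a\<in>Delta m s \<times> {..<s}. (\<lambda>N. (N(m := 0), N m)) ((\<lambda>(N, j). N(m := j)) a) = a"
    by (auto simp: Delta_def fun_eq_iff)
qed (auto simp: Delta_def less_Suc_eq)

lemma Delta_0: "Delta 0 s = {\<lambda>_. 0}"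
  by (auto simp: Delta_def)

lemma finite_Delta: "finite (Delta m s)"
proof (induction m)
  case (Suc m)
  then show ?case using bij_betw_finite[OF bij_betw_Delta_Suc[of m s]] by simp
qed (simp add: Delta_0)

lemma card_Delta: "card (Delta m s) = s ^ m"
proof (induction m)
  case (Suc m)
  then show ?case using bij_betw_same_card[OF bij_betw_Delta_Suc[of m s]]
    by (simp add: card_cartesian_product mult.commute)
qed (simp add: Delta_0)

lemma sum_Delta_Suc:
  "(\<Sum>N\<in>Delta (Suc m) s. f N) = (\<Sum>N\<in>Delta m s. \<Sum>j<s. f (N(m := j)))"
  using sum.reindex_bij_betw[OF bij_betw_Delta_Suc[of m s], of f, symmetric]
  by (simp add: sum.cartesian_product case_prod_unfold)

lemma fun_upd_in_Delta: "N \<in> Delta m s \<Longrightarrow> j < s \<Longrightarrow> N(m := j) \<in> Delta (Suc m) s"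
  by (auto simp: Delta_def less_Suc_eq)

lemma Delta_SucE:
  assumes "N \<in> Delta (Suc m) s"
  obtains N' j where "N' \<in> Delta m s" "j < s" "N = N'(m := j)"
  using assms bij_betw_imp_surj_on[OF bij_betw_Delta_Suc[of m s]] by force

lemma Dfun_Suc: "Dfun (Suc m) s (N(m := j)) = Dfun m s N * (s - j)"
  by (simp add: Dfun_def)

lemma Dperp_Suc: "Dperp (Suc m) (N(m := j)) = Dperp m N * (j + 1)"
  by (simp add: Dperp_def)

lemma evalmon_Suc: "evalmon (Suc m) (N(m := j)) (p(m := x)) = evalmon m N p * x ^ j"
  by (simp add: evalmon_def)

lemma bij_betw_points_Suc:
  "bij_betw (\<lambda>(p, x). p(m := x)) (points m S \<times> S m) (points (Suc m) S)"
proof -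
  have "bij_betw (\<lambda>(x, p). p(m := x)) (S m \<times> points m S) (points (Suc m) S)"
    unfolding bij_betw_def points_def lessThan_Suc
    by (auto simp: PiE_insert_eq intro!: inj_combinator)
  moreover have "bij_betw prod.swap (points m S \<times> S m) (S m \<times> points m S)"
    by (auto simp: bij_betw_def)
  ultimately show ?thesis
    by (auto dest: bij_betw_trans simp: comp_def case_prod_unfold)
qed

lemma points_0: "points 0 S = {\<lambda>_. undefined}"
  by (simp add: points_def)

lemma finite_points:
  fixes S :: "nat \<Rightarrow> 'a::finite set"
  shows "finite (points m S)"
  by (simp add: points_def finite_PiE)

lemma sum_points_Suc:
  "(\<Sum>p\<in>points (Suc m) S. f p) = (\<Sum>p\<in>points m S. \<Sum>x\<in>S m. f (p(m := x)))"
  using sum.reindex_bij_betw[OF bij_betw_points_Suc[of m S], of f, symmetric]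
  by (simp add: sum.cartesian_product case_prod_unfold)

lemma hweight_eq_sum: "finite P \<Longrightarrow> hweight P c = (\<Sum>p\<in>P. if c p \<noteq> 0 then 1 else 0)"
  by (simp add: hweight_def sum.If_cases Int_def)

lemma hweight_points_Suc:
  fixes S :: "nat \<Rightarrow> 'a::finite set"
  shows "hweight (points (Suc m) S) c
    = (\<Sum>p\<in>points m S. card {x \<in> S m. c (p(m := x)) \<noteq> 0})"
proof -
  have "card {x \<in> S m. c (p(m := x)) \<noteq> 0} = (\<Sum>x\<in>S m. if c (p(m := x)) \<noteq> 0 then 1 else 0)" for p
    by (simp add: sum.If_cases Int_def)
  then show ?thesis by (simp only: hweight_eq_sum[OF finite_points] sum_points_Suc)
qed

text \<open>The step shared by both weight bounds: only lines over non-zeros of \<open>b\<close> are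
  counted, each contributing at least \<open>k\<close>.\<close>

lemma hweight_le_slices:
  fixes S :: "nat \<Rightarrow> 'a::finite set"
  assumes "\<And>p. p \<in> points m S \<Longrightarrow> b p \<noteq> 0 \<Longrightarrow> k \<le> card {x \<in> S m. c (p(m := x)) \<noteq> 0}"
  shows "hweight (points m S) b * k \<le> hweight (points (Suc m) S) c"
proof -
  have "hweight (points m S) b * k = (\<Sum>p\<in>points m S. (if b p \<noteq> 0 then 1 else 0) * k)"
    by (simp add: hweight_eq_sum[OF finite_points] sum_distrib_right)
  also have "\<dots> \<le> (\<Sum>p\<in>points m S. card {x \<in> S m. c (p(m := x)) \<noteq> 0})"
    by (intro sum_mono) (use assms in auto)
  finally show ?thesis by (simp add: hweight_points_Suc)
qed

subsection \<open>Weights of codewords\<close>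

text \<open>The polynomial is nonzero of degree at most \<open>j\<close>, so at most
  \<open>j\<close> points of \<open>X\<close> are roots.\<close>

lemma card_nonroots_ge:
  fixes c :: "nat \<Rightarrow> 'a::idom"
  assumes "finite X" "c j \<noteq> 0" "j < s" "\<And>i. j < i \<Longrightarrow> i < s \<Longrightarrow> c i = 0"
  shows "card X - j \<le> card {x \<in> X. (\<Sum>i<s. c i * x ^ i) \<noteq> 0}"
proof -
  define q where "q = (\<Sum>i<s. monom (c i) i)"
  have poly: "poly q x = (\<Sum>i<s. c i * x ^ i)" for x
    by (simp add: q_def poly_sum poly_monom)
  have coeff: "coeff q i = (if i < s then c i else 0)" for i
    by (simp add: q_def coeff_sum)
  have "q \<noteq> 0" using coeff[of j] assms by auto
  have "degree q \<le> j" by (rule degree_le) (use coeff assms in auto)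
  have "card {x \<in> X. poly q x = 0} \<le> card {x. poly q x = 0}"
    by (rule card_mono) (use poly_roots_finite[OF \<open>q \<noteq> 0\<close>] in auto)
  also have "\<dots> \<le> j" using card_poly_roots_bound[OF \<open>q \<noteq> 0\<close>] \<open>degree q \<le> j\<close> by simp
  finally have "card {x \<in> X. poly q x = 0} \<le> j" .
  moreover have "card X = card {x \<in> X. poly q x = 0} + card {x \<in> X. poly q x \<noteq> 0}"
    using assms(1) by (subst card_Un_disjoint[symmetric]) (auto intro: arg_cong[where f = card])
  ultimately show ?thesis by (simp add: poly)
qed

text \<open>\<open>a N \<noteq> 0\<close> belongs to the conclusion so that the witness stays among
  the allowed exponents, where \<open>Dfun\<close> is bounded below.\<close>

lemma polynomial_weight:
  fixes S :: "nat \<Rightarrow> 'a::{finite,field} set"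
  assumes "\<forall>t<m. card (S t) = s" "\<exists>N\<in>Delta m s. a N \<noteq> 0"
  shows "\<exists>N\<in>Delta m s. a N \<noteq> 0 \<and>
    Dfun m s N \<le> hweight (points m S) (\<lambda>p. \<Sum>N\<in>Delta m s. a N * evalmon m N p)"
  using assms
proof (induction m arbitrary: a)
  case 0
  then show ?case by (simp add: Delta_0 Dfun_def hweight_def points_0 evalmon_def)
next
  case (Suc m)
  define J where "J = {j. j < s \<and> (\<exists>N\<in>Delta m s. a (N(m := j)) \<noteq> 0)}"
  have "finite J" by (auto simp: J_def)
  moreover have "J \<noteq> {}"
    using Suc.prems(2) by (auto simp: J_def elim!: Delta_SucE)
  ultimately have "Max J \<in> J" and Max: "\<And>i. i \<in> J \<Longrightarrow> i \<le> Max J" by auto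
  define j where "j = Max J"
  have j: "j < s" "\<exists>N\<in>Delta m s. a (N(m := j)) \<noteq> 0"
    using \<open>Max J \<in> J\<close> by (auto simp: j_def J_def)
  have above: "a (N(m := i)) = 0" if "j < i" "i < s" "N \<in> Delta m s" for i N
  proof (rule ccontr)
    assume "a (N(m := i)) \<noteq> 0"
    then have "i \<in> J" using that by (auto simp: J_def)
    then show False using Max[of i] that(1) by (simp add: j_def)
  qed
  \<comment> \<open>\<open>g i\<close> is the coefficient of the \<open>i\<close>-th power of the
    last variable, a polynomial in the first \<open>m\<close> variables.\<close>
  define g where "g i p = (\<Sum>N\<in>Delta m s. a (N(m := i)) * evalmon m N p)" for i p
  obtain N where N: "N \<in> Delta m s" "a (N(m := j)) \<noteq> 0" "Dfun m s N \<le> hweight (points m S) (g j)"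
    using Suc.IH[OF _ j(2)] Suc.prems(1) unfolding g_def by (meson less_SucI)
  define f where "f p = (\<Sum>N\<in>Delta (Suc m) s. a N * evalmon (Suc m) N p)" for p
  have f: "f (p(m := x)) = (\<Sum>i<s. g i p * x ^ i)" for p x
    unfolding f_def sum_Delta_Suc evalmon_Suc g_def sum_distrib_right
    by (subst sum.swap) (simp add: mult.assoc)
  have "hweight (points m S) (g j) * (s - j) \<le> hweight (points (Suc m) S) f"
  proof (rule hweight_le_slices)
    fix p assume "g j p \<noteq> 0"
    then show "s - j \<le> card {x \<in> S m. f (p(m := x)) \<noteq> 0}"
      using card_nonroots_ge[of "S m" "\<lambda>i. g i p" j s] Suc.prems(1) j(1) above
      by (simp add: f g_def)
  qed
  then have "Dfun (Suc m) s (N(m := j)) \<le> hweight (points (Suc m) S) f"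
    unfolding Dfun_Suc using N(3) by (meson le_trans mult_le_mono1)
  then show ?case using fun_upd_in_Delta[OF N(1) j(1)] N(2) unfolding f_def by blast
qed

text \<open>Pairing \<open>c\<close> with a polynomial that vanishes on its support except at
  \<open>y\<close> isolates \<open>c y\<close>. The degree is one less than the size of the support,
  so the moments below \<open>k\<close> suffice.\<close>

lemma moments_determine:
  fixes c :: "'a::field \<Rightarrow> 'a"
  assumes "finite X" "card {x \<in> X. c x \<noteq> 0} \<le> k" "\<And>i. i < k \<Longrightarrow> (\<Sum>x\<in>X. c x * x ^ i) = 0"
    and "y \<in> X"
  shows "c y = 0"
proof (rule ccontr)
  assume "c y \<noteq> 0"
  define A where "A = {x \<in> X. c x \<noteq> 0} - {y}"
  define q where "q = (\<Prod>z\<in>A. [:- z, 1:])"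
  have "finite A" using assms(1) by (simp add: A_def)
  have "card {x \<in> X. c x \<noteq> 0} = Suc (card A)"
    unfolding A_def by (rule card.remove) (use assms \<open>c y \<noteq> 0\<close> in auto)
  then have "card A < k" using assms(2) by simp
  moreover have "degree q = card A"
    unfolding q_def by (subst degree_prod_eq_sum_degree) auto
  ultimately have "degree q < k" by simp
  have "(\<Sum>x\<in>X. c x * poly q x) = (\<Sum>x\<in>X. \<Sum>i\<le>degree q. coeff q i * (c x * x ^ i))"
    by (simp add: poly_altdef sum_distrib_left algebra_simps)
  also have "\<dots> = (\<Sum>i\<le>degree q. coeff q i * (\<Sum>x\<in>X. c x * x ^ i))"
    by (subst sum.swap) (simp add: sum_distrib_left)
  also have "\<dots> = 0" using assms(3) \<open>degree q < k\<close> by simp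
  finally have "(\<Sum>x\<in>X. c x * poly q x) = 0" .
  moreover have "c x * poly q x = 0" if "x \<in> X - {y}" for x
    using that \<open>finite A\<close> by (auto simp: q_def poly_prod A_def)
  then have "(\<Sum>x\<in>X - {y}. c x * poly q x) = 0" by (intro sum.neutral) blast
  then have "(\<Sum>x\<in>X. c x * poly q x) = c y * poly q y"
    using assms(1,4) by (simp add: sum.remove[of X y])
  moreover have "poly q y \<noteq> 0" using \<open>finite A\<close> by (auto simp: q_def poly_prod A_def)
  ultimately show False using \<open>c y \<noteq> 0\<close> by simp
qed

text \<open>The nonzero pairing in the conclusion places the witness outside every set of exponents
  to which \<open>c\<close> is orthogonal.\<close>

lemma dual_weight:
  fixes S :: "nat \<Rightarrow> 'a::{finite,field} set"
  assumes "\<forall>t<m. card (S t) = s" "\<exists>p\<in>points m S. c p \<noteq> 0"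
  shows "\<exists>N\<in>Delta m s. (\<Sum>p\<in>points m S. c p * evalmon m N p) \<noteq> 0 \<and>
    Dperp m N \<le> hweight (points m S) c"
  using assms
proof (induction m arbitrary: c)
  case 0
  then have "{p. p = (\<lambda>_. undefined) \<and> c p \<noteq> 0} = {\<lambda>_. undefined}" by (auto simp: points_0)
  with 0 show ?case by (simp add: Delta_0 Dperp_def hweight_def points_0 evalmon_def)
next
  case (Suc m)
  define g where "g j p = (\<Sum>x\<in>S m. c (p(m := x)) * x ^ j)" for j p
  have "card (S m) = s" using Suc.prems(1) by simp
  obtain p x where px: "p \<in> points m S" "x \<in> S m" "c (p(m := x)) \<noteq> 0"
    using Suc.prems(2) bij_betw_imp_surj_on[OF bij_betw_points_Suc[of m S]] by force
  \<comment> \<open>A line has only \<open>s\<close> points, so some moment below \<open>s\<close>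
    is nonzero on a line where \<open>c\<close> does not vanish; thus \<open>j < s\<close>, as
    \<open>Delta\<close> demands.\<close>
  have "card {x \<in> S m. c (p(m := x)) \<noteq> 0} \<le> s"
    using \<open>card (S m) = s\<close> card_mono[of "S m" "{x \<in> S m. c (p(m := x)) \<noteq> 0}"] by auto
  then have ex: "\<exists>j. j < s \<and> (\<exists>p\<in>points m S. g j p \<noteq> 0)"
    using moments_determine[of "S m" "\<lambda>x. c (p(m := x))" s x] px unfolding g_def by (meson finite)
  define j where "j = (LEAST j. j < s \<and> (\<exists>p\<in>points m S. g j p \<noteq> 0))"
  have j: "j < s" "\<exists>p\<in>points m S. g j p \<noteq> 0"
    using LeastI_ex[OF ex] by (auto simp: j_def)
  have below: "g i p = 0" if "i < j" "p \<in> points m S" for i p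
    using not_less_Least[of i "\<lambda>j. j < s \<and> (\<exists>p\<in>points m S. g j p \<noteq> 0)"] that j(1)
    by (auto simp: j_def[symmetric])
  obtain N where N: "N \<in> Delta m s" "(\<Sum>p\<in>points m S. g j p * evalmon m N p) \<noteq> 0"
    "Dperp m N \<le> hweight (points m S) (g j)"
    using Suc.IH[OF _ j(2)] Suc.prems(1) by (meson less_SucI)
  have "hweight (points m S) (g j) * (j + 1) \<le> hweight (points (Suc m) S) c"
  proof (rule hweight_le_slices)
    fix p assume p: "p \<in> points m S" "g j p \<noteq> 0"
    show "j + 1 \<le> card {x \<in> S m. c (p(m := x)) \<noteq> 0}"
    proof (rule ccontr)
      assume "\<not> ?thesis"
      then have le: "card {x \<in> S m. c (p(m := x)) \<noteq> 0} \<le> j" by simp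
      have "c (p(m := x)) = 0" if "x \<in> S m" for x
        by (rule moments_determine[OF finite le below[OF _ p(1), unfolded g_def] that])
      then show False using p(2) by (simp add: g_def)
    qed
  qed
  then have weight: "Dperp (Suc m) (N(m := j)) \<le> hweight (points (Suc m) S) c"
    unfolding Dperp_Suc using N(3) by (meson le_trans mult_le_mono1)
  have "(\<Sum>p\<in>points (Suc m) S. c p * evalmon (Suc m) (N(m := j)) p)
      = (\<Sum>p\<in>points m S. g j p * evalmon m N p)"
    unfolding sum_points_Suc evalmon_Suc g_def sum_distrib_right
    by (simp only: mult.assoc mult.commute[of "_ ^ j"])
  then have "(\<Sum>p\<in>points (Suc m) S. c p * evalmon (Suc m) (N(m := j)) p) \<noteq> 0"
    using N(2) by (rule ssubst)
  with weight show ?case by (intro bexI[OF _ fun_upd_in_Delta[OF N(1) j(1)]] conjI)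
qed

subsection \<open>Dimensions\<close>

interpretation word_space: vector_space "wscale :: 'a::field \<Rightarrow> ('p \<Rightarrow> 'a) \<Rightarrow> 'p \<Rightarrow> 'a"
  by unfold_locales (auto simp: wscale_def fun_eq_iff algebra_simps)

definition evword :: "nat \<Rightarrow> (nat \<Rightarrow> 'a set) \<Rightarrow> (nat \<Rightarrow> nat) \<Rightarrow> (nat \<Rightarrow> 'a) \<Rightarrow> 'a::field" where
  "evword m S N = (\<lambda>p. if p \<in> points m S then evalmon m N p else 0)"

lemma sum_fun_apply: "(\<Sum>i\<in>A. f i) x = (\<Sum>i\<in>A. f i x :: 'b::comm_monoid_add)"
  by (induction A rule: infinite_finite_induct) auto

lemma sum_evword:
  "(\<Sum>N\<in>L. wscale (a N) (evword m S N))
    = (\<lambda>p. if p \<in> points m S then \<Sum>N\<in>L. a N * evalmon m N p else 0)"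
  by (rule ext) (simp add: sum_fun_apply wscale_def evword_def)

lemma evcode_eq: "evcode m S L = range (\<lambda>a. \<Sum>N\<in>L. wscale (a N) (evword m S N))"
  by (auto simp: evcode_def sum_evword)

section \<open>Linear independence of the evaluated monomials\<close>

lemma evcode_weight:
  fixes S :: "nat \<Rightarrow> 'a::{finite,field} set"
  assumes "\<forall>t<m. card (S t) = s" "L \<subseteq> Delta m s" "\<exists>N\<in>L. a N \<noteq> 0"
  shows "\<exists>N\<in>L. a N \<noteq> 0 \<and>
    Dfun m s N \<le> hweight (points m S) (\<Sum>N\<in>L. wscale (a N) (evword m S N))"
proof -
  \<comment> \<open>Extending by \<open>0\<close> turns the combination into a full polynomial; a
    witness with \<open>b N \<noteq> 0\<close> then lies in \<open>L\<close> automatically.\<close>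
  define b where "b N = (if N \<in> L then a N else 0)" for N
  have sum_b: "(\<Sum>N\<in>Delta m s. b N * evalmon m N p) = (\<Sum>N\<in>L. a N * evalmon m N p)" for p
    using assms(2) by (intro sum.mono_neutral_cong_right finite_Delta) (auto simp: b_def)
  have "hweight (points m S) (\<lambda>p. \<Sum>N\<in>Delta m s. b N * evalmon m N p)
      = hweight (points m S) (\<Sum>N\<in>L. wscale (a N) (evword m S N))"
    by (simp add: hweight_def sum_evword sum_b cong: conj_cong)
  moreover have "\<exists>N\<in>Delta m s. b N \<noteq> 0" using assms by (auto simp: b_def)
  ultimately show ?thesis
    using polynomial_weight[OF assms(1), of b] by (auto simp: b_def split: if_splits)
qed

lemma Dfun_pos: "N \<in> Delta m s \<Longrightarrow> 0 < Dfun m s N"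
  by (auto simp: Dfun_def Delta_def)

text \<open>By the weight bound a nontrivial combination has weight at least some
  \<open>Dfun\<close>, which is positive, while the zero word has weight 0.\<close>

lemma sum_evword_eq_0D:
  fixes S :: "nat \<Rightarrow> 'a::{finite,field} set"
  assumes "\<forall>t<m. card (S t) = s" "L \<subseteq> Delta m s"
    "(\<Sum>N\<in>L. wscale (a N) (evword m S N)) = 0" "N \<in> L"
  shows "a N = 0"
proof (rule ccontr)
  assume "a N \<noteq> 0"
  then obtain N' where "N' \<in> L" "Dfun m s N' \<le> hweight (points m S) (0 :: (nat \<Rightarrow> 'a) \<Rightarrow> 'a)"
    using evcode_weight[OF assms(1,2), of a] assms(3,4) by auto
  then show False using Dfun_pos[of N' m s] assms(2) by (auto simp: hweight_def)
qed

text \<open>Two equal words would give a vanishing combination with coefficients 1 and -1.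
  Injectivity lets coefficients indexed by words be reread as coefficients indexed by
  exponents.\<close>

lemma inj_on_evword:
  fixes S :: "nat \<Rightarrow> 'a::{finite,field} set"
  assumes "\<forall>t<m. card (S t) = s"
  shows "inj_on (evword m S) (Delta m s)"
proof (rule inj_onI, rule ccontr)
  fix N K assume NK: "N \<in> Delta m s" "K \<in> Delta m s" "evword m S N = evword m S K" "N \<noteq> K"
  define a :: "(nat \<Rightarrow> nat) \<Rightarrow> 'a" where "a = (\<lambda>M. if M = N then 1 else -1)"
  have "(\<Sum>M\<in>{N, K}. wscale (a M) (evword m S M)) = wscale 1 (evword m S N) + wscale (-1) (evword m S K)"
    using NK(4) by (simp add: a_def)
  also have "\<dots> = 0"
    by (simp only: NK(3)) (simp add: wscale_def fun_eq_iff)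
  finally have "(\<Sum>M\<in>{N, K}. wscale (a M) (evword m S M)) = 0" .
  then have "a N = 0" by (rule sum_evword_eq_0D[OF assms, rotated]) (use NK in auto)
  then show False by (simp add: a_def)
qed

lemma independent_evword:
  fixes S :: "nat \<Rightarrow> 'a::{finite,field} set"
  assumes "\<forall>t<m. card (S t) = s"
  shows "word_space.independent (evword m S ` Delta m s)"
proof -
  have "u v = 0"
    if A: "A \<subseteq> evword m S ` Delta m s" "(\<Sum>v\<in>A. wscale (u v) v) = 0" "v \<in> A" for A u v
  proof -
    obtain L where L: "L \<subseteq> Delta m s" "A = evword m S ` L"
      using A(1) by (rule subset_imageE)
    obtain N where N: "N \<in> L" "v = evword m S N" using A(3) L(2) by blast
    define a where "a N = u (evword m S N)" for N
    have "inj_on (evword m S) L" using inj_on_evword[OF assms] L(1) by (rule inj_on_subset)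
    then have "(\<Sum>N\<in>L. wscale (a N) (evword m S N)) = (\<Sum>v\<in>A. wscale (u v) v)"
      unfolding a_def L(2) by (simp only: sum.reindex o_def)
    then have "a N = 0" using sum_evword_eq_0D[OF assms L(1) _ N(1)] A(2) by simp
    then show ?thesis by (simp only: a_def N(2))
  qed
  then show ?thesis
    unfolding word_space.independent_explicit_finite_subsets by blast
qed

lemma evcode_eq_span:
  fixes S :: "nat \<Rightarrow> 'a::{finite,field} set"
  assumes "\<forall>t<m. card (S t) = s" "L \<subseteq> Delta m s"
  shows "evcode m S L = word_space.span (evword m S ` L)"
proof
  show "evcode m S L \<subseteq> word_space.span (evword m S ` L)"
    unfolding evcode_eq
    by (intro image_subsetI word_space.span_sum word_space.span_scale word_space.span_base imageI)
  have inj: "inj_on (evword m S) L" using inj_on_evword[OF assms(1)] assms(2) by (rule inj_on_subset)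
  have "finite L" using assms(2) finite_Delta finite_subset by blast
  then show "word_space.span (evword m S ` L) \<subseteq> evcode m S L"
    unfolding evcode_eq
    by (simp add: word_space.span_finite sum.reindex[OF inj]) (auto intro: rangeI)
qed

lemma wdim_evcode:
  fixes S :: "nat \<Rightarrow> 'a::{finite,field} set"
  assumes "\<forall>t<m. card (S t) = s" "L \<subseteq> Delta m s"
  shows "wdim (evcode m S L) = card L"
proof -
  have "word_space.independent (evword m S ` L)"
    using independent_evword[OF assms(1)] assms(2) word_space.independent_mono by blast
  then have "wdim (evcode m S L) = card (evword m S ` L)"
    unfolding wdim_def evcode_eq_span[OF assms]
    by (simp add: word_space.dim_eq_card_independent)
  also have "\<dots> = card L"
    using inj_on_evword[OF assms(1)] assms(2) by (auto intro: card_image inj_on_subset)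
  finally show ?thesis .
qed

subsection \<open>Counting\<close>

text \<open>
  \<open>s ^ m * vol m (s ^ m / d)\<close> is the volume of the part of the cube \<open>[0, s]\<^sup>m\<close> where the product
  of the coordinates is at most \<open>d\<close>. The function \<open>y * vol (Suc m) y\<close> is concave with derivative
  \<open>vol m y\<close>, which turns slicing the cube into the sum estimate \<open>sum_vol_le\<close>.
\<close>

definition log_poly :: "nat \<Rightarrow> real \<Rightarrow> real" where
  "log_poly m y = (\<Sum>t<m. ln y ^ t / fact t)"

definition vol :: "nat \<Rightarrow> real \<Rightarrow> real" where
  "vol m y = (if y \<le> 1 then 1 else log_poly m y / y)"

text \<open>Differentiating each term lowers its power of \<open>ln y\<close> by one and divides by
  \<open>y\<close>; the constant term drops out.\<close>

lemma log_poly_Suc_deriv: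
  assumes "y > 0"
  shows "(log_poly (Suc m) has_real_derivative log_poly m y / y) (at y)"
proof -
  have "((\<lambda>y. ln y ^ Suc t / fact (Suc t)) has_real_derivative
      (1 + real t) * (1 / y * ln y ^ t) / fact (Suc t)) (at y)" for t
    by (intro DERIV_cdivide DERIV_power_Suc DERIV_ln_divide assms)
  moreover have "(1 + real t) * (1 / y * ln y ^ t) / fact (Suc t) = ln y ^ t / fact t / y" for t
    by (simp add: divide_simps)
  ultimately have "((\<lambda>y. \<Sum>t<m. ln y ^ Suc t / fact (Suc t)) has_real_derivative
      (\<Sum>t<m. ln y ^ t / fact t / y)) (at y)"
    by (intro DERIV_sum) (simp only:)
  moreover have "log_poly (Suc m) = (\<lambda>y. 1 + (\<Sum>t<m. ln y ^ Suc t / fact (Suc t)))"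
    unfolding log_poly_def by (subst sum.lessThan_Suc_shift) simp
  ultimately show ?thesis
    using DERIV_add[OF DERIV_const[of 1]] by (fastforce simp: log_poly_def sum_divide_distrib)
qed

lemma log_poly_1: "log_poly m 1 = (if m = 0 then 0 else 1)"
  by (cases m) (simp_all add: log_poly_def sum.lessThan_Suc_shift del: sum.lessThan_Suc)

lemma log_poly_mono: "m \<le> m' \<Longrightarrow> 1 \<le> y \<Longrightarrow> log_poly m y \<le> log_poly m' y"
  unfolding log_poly_def by (rule sum_mono2) auto

text \<open>The numerator of the derivative is \<open>log_poly k x - log_poly (Suc k) x\<close>,
  which is nonpositive for \<open>x \<ge> 1\<close>. This is the concavity of
  \<open>log_poly (Suc m)\<close>.\<close>

lemma log_poly_div_antimono:
  assumes "1 \<le> y" "y \<le> z"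
  shows "log_poly m z / z \<le> log_poly m y / y"
proof (cases m)
  case (Suc k)
  show ?thesis
  proof (rule DERIV_nonpos_imp_nonincreasing[OF assms(2)], intro exI conjI)
    fix x assume "y \<le> x" "x \<le> z"
    then have "1 \<le> x" using assms by simp
    then show "((\<lambda>x. log_poly m x / x) has_real_derivative
        (log_poly k x / x * x - log_poly (Suc k) x * 1) / (x * x)) (at x)"
      unfolding Suc by (intro DERIV_divide log_poly_Suc_deriv DERIV_ident) auto
    show "(log_poly k x / x * x - log_poly (Suc k) x * 1) / (x * x) \<le> 0"
      using log_poly_mono[of k "Suc k" x] \<open>1 \<le> x\<close> by (intro divide_nonpos_pos) auto
  qed
qed (simp add: log_poly_def)

text \<open>Mean value theorem: the slope at the intermediate point is at least the slope at the
  right end.\<close>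

lemma log_poly_Suc_diff_ge:
  assumes "1 \<le> y" "y \<le> z"
  shows "(z - y) * (log_poly m z / z) \<le> log_poly (Suc m) z - log_poly (Suc m) y"
proof (cases "y = z")
  case False
  then have "y < z" using assms by simp
  moreover have "\<And>x. y \<le> x \<Longrightarrow> x \<le> z \<Longrightarrow>
      (log_poly (Suc m) has_real_derivative log_poly m x / x) (at x)"
    using assms by (intro log_poly_Suc_deriv) simp
  ultimately obtain x where x: "y < x" "x < z"
    "log_poly (Suc m) z - log_poly (Suc m) y = (z - y) * (log_poly m x / x)"
    using MVT2[of y z "log_poly (Suc m)" "\<lambda>x. log_poly m x / x"] by blast
  then show ?thesis
    using log_poly_div_antimono[of x z m] assms by (simp only: x(3)) (intro mult_left_mono, auto)
qed simp

text \<open>Both branches of \<open>vol\<close> agree at \<open>y = 1\<close> once \<open>m\<close>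
  is positive; for \<open>m = 0\<close> there is a jump.\<close>

lemma vol_ge_1: "0 < m \<Longrightarrow> 1 \<le> y \<Longrightarrow> vol m y = log_poly m y / y"
  by (auto simp: vol_def log_poly_1)

lemma vol_step:
  assumes "0 \<le> y" "y \<le> z"
  shows "(z - y) * vol m z \<le> z * vol (Suc m) z - y * vol (Suc m) y"
proof -
  have upper: "z' * vol (Suc m) z' = log_poly (Suc m) z'" if "1 \<le> z'" for z'
    using that by (simp add: vol_ge_1)
  consider "z \<le> 1" | "1 \<le> y" "1 < z" | "y < 1" "1 < z" using assms by linarith
  then show ?thesis
  proof cases
    case 1 then show ?thesis using assms by (simp add: vol_def)
  next
    case 2
    have "(z - y) * (log_poly m z / z) \<le> log_poly (Suc m) z - log_poly (Suc m) y"
      using 2 assms by (intro log_poly_Suc_diff_ge) auto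
    then show ?thesis using 2 assms by (simp add: upper) (simp add: vol_def)
  next
    \<comment> \<open>The interval is split at 1: on the left part \<open>y * vol (Suc m) y\<close>
      has slope 1, which bounds \<open>vol m z\<close>; on the right part it is
      \<open>log_poly (Suc m)\<close>.\<close>
    case 3
    have "log_poly m z / z \<le> log_poly m 1 / 1" using 3 by (intro log_poly_div_antimono) auto
    also have "\<dots> \<le> 1" by (simp add: log_poly_1)
    finally have "(1 - y) * (log_poly m z / z) \<le> (1 - y) * 1"
      using 3 by (intro mult_left_mono) auto
    moreover have "(z - 1) * (log_poly m z / z) \<le> log_poly (Suc m) z - log_poly (Suc m) 1"
      using 3 by (intro log_poly_Suc_diff_ge) auto
    moreover have "(z - y) * (log_poly m z / z)
        = (1 - y) * (log_poly m z / z) + (z - 1) * (log_poly m z / z)"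
      by (simp only: left_diff_distrib)
    moreover have "log_poly (Suc m) 1 = 1" by (simp add: log_poly_1)
    ultimately have "(z - y) * (log_poly m z / z) \<le> log_poly (Suc m) z - y"
      by (simp only: mult_1_right)
    moreover have "vol m z = log_poly m z / z" "vol (Suc m) y = 1"
      using 3 by (simp_all add: vol_def)
    ultimately show ?thesis using 3 upper[of z] by (simp only: mult_1_right)
  qed
qed

lemma sum_vol_le:
  assumes "0 < h"
  shows "(\<Sum>a=1..s. h * vol m (h * real a)) \<le> h * real s * vol (Suc m) (h * real s)"
proof (induction s)
  case (Suc s)
  \<comment> \<open>\<open>vol_step\<close> on one interval of length \<open>h\<close>; the
    differences telescope.\<close>
  have "h * vol m (h * real (Suc s))
      \<le> h * real (Suc s) * vol (Suc m) (h * real (Suc s)) - h * real s * vol (Suc m) (h * real s)"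
    using vol_step[of "h * real s" "h * real (Suc s)" m] assms by (simp add: algebra_simps)
  then show ?case using Suc by simp
qed simp

text \<open>The parameter \<open>g\<close> lets one count serve \<open>Dfun\<close> and
  \<open>Dperp\<close>. The bound \<open>d\<close> is real because slicing at \<open>j\<close>
  replaces it by \<open>d / g j\<close>.\<close>

lemma card_prod_le:
  fixes g :: "nat \<Rightarrow> nat"
  assumes g: "bij_betw g {..<s} {1..s}" and "0 < s" "0 < d"
  shows "real (card {N \<in> Delta m s. real (\<Prod>t<m. g (N t)) \<le> d}) \<le> real s ^ m * vol m (real s ^ m / d)"
  using \<open>0 < d\<close>
proof (induction m arbitrary: d)
  case 0
  \<comment> \<open>The empty product 1 is counted exactly if \<open>1 \<le> d\<close>, which is
    where \<open>vol 0 (1 / d)\<close> jumps from 0 to 1.\<close>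
  then show ?case by (auto simp: Delta_0 vol_def log_poly_def)
next
  case (Suc m)
  let ?A = "\<lambda>m d. {N \<in> Delta m s. real (\<Prod>t<m. g (N t)) \<le> d}"
  have count: "real (card (?A m d)) = (\<Sum>N\<in>Delta m s. if real (\<Prod>t<m. g (N t)) \<le> d then 1 else 0)"
    for m d by (simp add: sum.If_cases[OF finite_Delta] Int_def)
  have pos: "0 < g j" if "j < s" for j using bij_betwE[OF g] that by (simp add: Suc_le_eq)
  have "real (card (?A (Suc m) d))
      = (\<Sum>N\<in>Delta m s. \<Sum>j<s. if real (\<Prod>t<m. g (N t)) * real (g j) \<le> d then 1 else 0)"
    unfolding count sum_Delta_Suc by simp
  also have "\<dots> = (\<Sum>j<s. \<Sum>N\<in>Delta m s. if real (\<Prod>t<m. g (N t)) \<le> d / real (g j) then 1 else 0)"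
    by (subst sum.swap) (intro sum.cong refl, simp add: pos pos_le_divide_eq)
  also have "\<dots> = (\<Sum>j<s. real (card (?A m (d / real (g j)))))"
    by (simp only: count)
  also have "\<dots> \<le> (\<Sum>j<s. real s ^ m * vol m (real s ^ m / (d / real (g j))))"
    by (intro sum_mono Suc.IH) (use Suc.prems pos in simp)
  \<comment> \<open>A factor \<open>d\<close> is pulled out to expose the step size
    \<open>h = s ^ m / d\<close> of \<open>sum_vol_le\<close>.\<close>
  also have "\<dots> = d * (\<Sum>j<s. (real s ^ m / d) * vol m ((real s ^ m / d) * real (g j)))"
    using Suc.prems by (simp add: sum_distrib_left)
  also have "\<dots> = d * (\<Sum>a=1..s. (real s ^ m / d) * vol m ((real s ^ m / d) * real a))"
    
    by (subst sum.reindex_bij_betw[OF g, symmetric]) (rule refl)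
  also have "\<dots> \<le> d * ((real s ^ m / d) * real s * vol (Suc m) ((real s ^ m / d) * real s))"
    using Suc.prems \<open>0 < s\<close> by (intro mult_left_mono sum_vol_le) auto
  also have "\<dots> = real s ^ Suc m * vol (Suc m) (real s ^ Suc m / d)"
    using Suc.prems by (simp add: mult_ac)
  finally show ?case .
qed


text \<open>\<open>d \<le> s ^ m\<close> puts the argument of \<open>vol\<close> in the logarithmic
  branch, where \<open>s ^ m\<close> cancels and leaves
  \<open>d * log_poly m (s ^ m / d)\<close>.\<close>

lemma card_prod_less_le:
  fixes g :: "nat \<Rightarrow> nat"
  assumes g: "bij_betw g {..<s} {1..s}" and "0 < s" "0 < m" "0 < d" "d \<le> s ^ m"
  shows "real (card {N \<in> Delta m s. (\<Prod>t<m. g (N t)) < d})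
    \<le> (\<Sum>t=1..m. (1 / fact (t - 1)) * (real d * ln (real s ^ m / real d) ^ (t - 1)))"
proof -
  have "card {N \<in> Delta m s. (\<Prod>t<m. g (N t)) < d}
      \<le> card {N \<in> Delta m s. real (\<Prod>t<m. g (N t)) \<le> real d}"
    by (rule card_mono) (auto simp: finite_Delta simp flip: of_nat_prod)
  then have "real (card {N \<in> Delta m s. (\<Prod>t<m. g (N t)) < d})
      \<le> real (card {N \<in> Delta m s. real (\<Prod>t<m. g (N t)) \<le> real d})"
    by (rule of_nat_mono)
  also have "\<dots> \<le> real s ^ m * vol m (real s ^ m / real d)"
    by (rule card_prod_le[OF g]) (use assms in simp_all)
  also have "\<dots> = real d * log_poly m (real s ^ m / real d)"
  proof -
    have "real d \<le> real (s ^ m)" using assms(5) by (simp only: of_nat_le_iff)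
    then have "1 \<le> real s ^ m / real d" using \<open>0 < d\<close> by (simp add: le_divide_eq)
    then have "vol m (real s ^ m / real d) = log_poly m (real s ^ m / real d) / (real s ^ m / real d)"
      by (rule vol_ge_1[OF \<open>0 < m\<close>])
    then show ?thesis using \<open>0 < d\<close> \<open>0 < s\<close> by simp
  qed
  also have "\<dots> = (\<Sum>t<m. (1 / fact t) * (real d * ln (real s ^ m / real d) ^ t))"
    unfolding log_poly_def sum_distrib_left by (intro sum.cong refl) simp
  also have "\<dots> = (\<Sum>t=1..m. (1 / fact (t - 1)) * (real d * ln (real s ^ m / real d) ^ (t - 1)))"
    by (simp only: One_nat_def sum.atLeast1_atMost_eq diff_Suc_Suc minus_nat.diff_0)
  finally show ?thesis .
qed

subsection \<open>Comparing \<open>Dfun\<close> and \<open>Dperp\<close>\<close>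

text \<open>
  By log-concavity the product of the \<open>s + 1 - a t\<close> for a fixed product of the \<open>a t\<close> is smallest
  at an extreme point, where all but one of the \<open>a t\<close> equal \<open>1\<close> or \<open>s\<close>.
\<close>

lemma prod_reflect_ge:
  fixes a :: "nat \<Rightarrow> real"
  assumes "1 \<le> s" "\<And>t. t \<le> k \<Longrightarrow> 1 \<le> a t \<and> a t \<le> s"
  shows "\<exists>v\<le>k. \<exists>b. 1 \<le> b \<and> b \<le> s \<and> (\<Prod>t\<le>k. a t) = s ^ v * b \<and>
    (s + 1 - b) * s ^ (k - v) \<le> (\<Prod>t\<le>k. s + 1 - a t)"
  using assms(2)
proof (induction k)
  case 0
  then show ?case by (intro exI[of _ 0] conjI exI[of _ "a 0"]) auto
next
  case (Suc k)
  \<comment> \<open>The extreme point has \<open>v\<close> entries \<open>s\<close>, one entry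
    \<open>b\<close> and \<open>k - v\<close> entries 1; their reflections are 1,
    \<open>s + 1 - b\<close> and \<open>s\<close>.\<close>
  obtain v b where v: "v \<le> k" and b: "1 \<le> b" "b \<le> s" "(\<Prod>t\<le>k. a t) = s ^ v * b"
    and le: "(s + 1 - b) * s ^ (k - v) \<le> (\<Prod>t\<le>k. s + 1 - a t)"
    using Suc.IH Suc.prems by (meson le_SucI)
  define x where "x = a (Suc k)"
  have x: "1 \<le> x" "x \<le> s" using Suc.prems[of "Suc k"] by (simp_all add: x_def)
  have "((s + 1 - b) * s ^ (k - v)) * (s + 1 - x) \<le> (\<Prod>t\<le>k. s + 1 - a t) * (s + 1 - x)"
    using le x by (intro mult_right_mono) auto
  then have step: "((s + 1 - b) * (s + 1 - x)) * s ^ (k - v) \<le> (\<Prod>t\<le>Suc k. s + 1 - a t)"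
    by (simp add: x_def mult_ac)
  have pw: "0 \<le> s ^ (k - v)" using assms(1) by simp
  \<comment> \<open>With \<open>b * x\<close> fixed, the pair \<open>b\<close>, \<open>x\<close>
    moves to \<open>b * x\<close>, 1 if this fits below \<open>s\<close>, else to \<open>s\<close>,
    \<open>b * x / s\<close>. The loss in the reflected product is a visibly nonnegative expression
    in each case.\<close>
  show ?case
  proof (cases "b * x \<le> s")
    case True
    have "0 \<le> (s + 1) * ((x - 1) * (b - 1))" using x b assms(1) by simp
    then have "(s + 1 - b * x) * s \<le> (s + 1 - b) * (s + 1 - x)" by (simp add: algebra_simps)
    from mult_right_mono[OF this pw]
    have "(s + 1 - b * x) * s ^ (Suc k - v) \<le> (\<Prod>t\<le>Suc k. s + 1 - a t)"
      using step v by (simp add: Suc_diff_le mult.assoc)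
    moreover have "1 \<le> b * x" using mult_mono[of 1 b 1 x] b x by simp
    ultimately show ?thesis
      using v True b(3) by (intro exI[of _ v] conjI exI[of _ "b * x"]) (auto simp: x_def)
  next
    case False
    have "0 \<le> (s + 1) * ((s - x) * (s - b)) / s" using x b assms(1) by simp
    also have "\<dots> = (s + 1 - b) * (s + 1 - x) - (s + 1 - b * x / s)"
      using assms(1) by (simp add: field_simps)
    finally have "(s + 1 - b * x / s) \<le> (s + 1 - b) * (s + 1 - x)" by simp
    from mult_right_mono[OF this pw]
    have "(s + 1 - b * x / s) * s ^ (Suc k - Suc v) \<le> (\<Prod>t\<le>Suc k. s + 1 - a t)"
      using step by simp
    moreover have "b * x \<le> s * s" using mult_mono[of b s x s] b x by simp
    ultimately show ?thesis
      using v False b(3) assms(1)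
      by (intro exI[of _ "Suc v"] conjI exI[of _ "b * x / s"]) (auto simp: x_def field_simps)
  qed
qed

text \<open>This gives \<open>L2 \<subseteq> L1\<close> by contraposition. The reflection of
  \<open>s - N t\<close> is \<open>N t + 1\<close>, so \<open>prod_reflect_ge\<close> links the two
  products.\<close>

lemma Dperp_ge_of_Dfun_less:
  assumes "N \<in> Delta m s" "1 \<le> s" "v < m" "s ^ v \<le> d" "d \<le> s ^ (v + 1)" "Dfun m s N < d"
  shows "(real s - real d / real s ^ v + 1) * real s ^ (m - v - 1) \<le> real (Dperp m N)"
proof -
  define k where "k = m - 1"
  have m: "{..<m} = {..k}" using assms(3) by (auto simp: k_def)
  define a where "a t = real (s - N t)" for t
  have lt: "N t < s" if "t \<le> k" for t using assms(1,3) that by (auto simp: Delta_def k_def)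
  have a: "1 \<le> a t \<and> a t \<le> real s" if "t \<le> k" for t using lt[OF that] by (simp add: a_def)
  have "real s + 1 - a t = real (N t + 1)" if "t \<le> k" for t
    using lt[OF that] by (simp add: a_def of_nat_diff)
  then have perp: "(\<Prod>t\<le>k. real s + 1 - a t) = real (Dperp m N)"
    unfolding Dperp_def m of_nat_prod by (intro prod.cong) auto
  obtain w b where w: "w \<le> k" and b: "1 \<le> b" "b \<le> real s" "(\<Prod>t\<le>k. a t) = real s ^ w * b"
    and le: "(real s + 1 - b) * real s ^ (k - w) \<le> real (Dperp m N)"
    using prod_reflect_ge[of "real s" k a] a assms(2) unfolding perp by auto
  have "(\<Prod>t\<le>k. a t) = real (Dfun m s N)" by (simp add: Dfun_def m a_def)
  then have less: "real s ^ w * b < real d" using b(3) assms(6) by simp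
  define c where "c = real d / real s ^ v"
  have s: "0 < real s ^ v" using assms(2) by simp
  have d: "real (s ^ v) \<le> real d" "real d \<le> real (s ^ (v + 1))"
    using assms(4,5) by (simp_all only: of_nat_le_iff)
  then have c: "1 \<le> c" "real d = real s ^ v * c" using s by (simp_all add: c_def field_simps)
  \<comment> \<open>The extreme point \<open>s ^ w * b\<close> lies below
    \<open>d = s ^ v * c\<close>. If \<open>w < v\<close>, an extra factor \<open>s\<close>
    suffices; if \<open>w = v\<close>, then \<open>b \<le> c\<close>; and \<open>w > v\<close> would
    force \<open>s ^ w * b\<close> up to at least \<open>d\<close>.\<close>
  have "(real s + 1 - c) * real s ^ (k - v) \<le> (real s + 1 - b) * real s ^ (k - w)"
  proof (cases w v rule: linorder_cases)
    case less
    then have "Suc (k - v) \<le> k - w" using assms(3) by (simp add: k_def)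
    have "(real s + 1 - c) * real s ^ (k - v) \<le> real s * real s ^ (k - v)"
      using c(1) by (intro mult_right_mono) auto
    also have "\<dots> = real s ^ Suc (k - v)" by simp
    also have "\<dots> \<le> real s ^ (k - w)"
      using \<open>Suc (k - v) \<le> k - w\<close> assms(2) by (intro power_increasing) auto
    also have "\<dots> \<le> (real s + 1 - b) * real s ^ (k - w)"
      using mult_right_mono[of 1 "real s + 1 - b" "real s ^ (k - w)"] b(2) by simp
    finally show ?thesis .
  next
    case equal
    then have "b \<le> c" using less s by (simp add: c(2))
    then show ?thesis using equal by (intro mult_mono) (use b in auto)
  next
    case greater
    then have "real s ^ (v + 1) * 1 \<le> real s ^ w * b"
      using assms(2) b(1) by (intro mult_mono power_increasing) auto
    then show ?thesis using less d(2) by simp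
  qed
  then show ?thesis using le by (simp add: c_def k_def algebra_simps)
qed

subsection \<open>Dual codes\<close>

lemma dualcode_evcode_iff:
  assumes "finite L"
  shows "c \<in> dualcode (points m S) (evcode m S L) \<longleftrightarrow>
    c \<in> words (points m S) \<and> (\<forall>N\<in>L. (\<Sum>p\<in>points m S. c p * evalmon m N p) = 0)"
    (is "_ \<longleftrightarrow> _ \<and> ?orth")
proof -
  have pairing: "(\<Sum>p\<in>points m S. c p * (if p \<in> points m S then \<Sum>N\<in>L. a N * evalmon m N p else 0))
      = (\<Sum>N\<in>L. a N * (\<Sum>p\<in>points m S. c p * evalmon m N p))" for a
    unfolding sum_distrib_left
    by (subst sum.swap) (auto simp: sum_distrib_left mult_ac intro!: sum.cong)
  \<comment> \<open>Indicator coefficients single out one generator, so orthogonality to the code is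
    orthogonality to each evaluated monomial.\<close>
  have unit: "(\<Sum>K\<in>L. (if K = N then 1 else 0) * f K) = f N" if "N \<in> L" for N and f :: "_ \<Rightarrow> 'a"
    using that assms by (simp add: if_distrib[of "\<lambda>x. x * _"] sum.delta cong: if_cong)
  have "(\<forall>a. (\<Sum>N\<in>L. a N * (\<Sum>p\<in>points m S. c p * evalmon m N p)) = 0) \<longleftrightarrow> ?orth"
  proof
    assume all: "\<forall>a. (\<Sum>N\<in>L. a N * (\<Sum>p\<in>points m S. c p * evalmon m N p)) = 0"
    show ?orth
    proof
      fix N assume "N \<in> L"
      show "(\<Sum>p\<in>points m S. c p * evalmon m N p) = 0"
        using unit[OF \<open>N \<in> L\<close>] all[rule_format, of "\<lambda>K. if K = N then 1 else 0"] by metis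
    qed
  qed simp
  moreover have "c \<in> dualcode (points m S) (evcode m S L) \<longleftrightarrow> c \<in> words (points m S) \<and>
      (\<forall>a. (\<Sum>N\<in>L. a N * (\<Sum>p\<in>points m S. c p * evalmon m N p)) = 0)"
    unfolding dualcode_def evcode_def pairing[symmetric] by auto
  ultimately show ?thesis by blast
qed

text \<open>By independence a linear functional can be prescribed on the evaluated monomials; its
  values on the unit words \<open>e p\<close> are the entries of \<open>c\<close>.\<close>

lemma exists_dual_word:
  fixes S :: "nat \<Rightarrow> 'a::{finite,field} set"
  assumes "\<forall>t<m. card (S t) = s" "N \<in> Delta m s"
  obtains c where "c \<in> words (points m S)"
    "\<And>K. K \<in> Delta m s \<Longrightarrow> (\<Sum>p\<in>points m S. c p * evalmon m K p) = (if K = N then 1 else 0)"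
proof -
  interpret pair: vector_space_pair "wscale :: 'a \<Rightarrow> ((nat \<Rightarrow> 'a) \<Rightarrow> 'a) \<Rightarrow> _" "(*) :: 'a \<Rightarrow> 'a \<Rightarrow> 'a"
    by unfold_locales (auto simp: algebra_simps)
  obtain g where g: "Vector_Spaces.linear wscale (*) g"
    "\<forall>x\<in>evword m S ` Delta m s. g x = (if x = evword m S N then 1 else 0)"
    
    using pair.linear_independent_extend[OF independent_evword[OF assms(1)],
      of "\<lambda>x. if x = evword m S N then 1 else 0"] by blast
  define e :: "(nat \<Rightarrow> 'a) \<Rightarrow> (nat \<Rightarrow> 'a) \<Rightarrow> 'a" where "e p = (\<lambda>q. if q = p then 1 else 0)" for p
  define c where "c p = (if p \<in> points m S then g (e p) else 0)" for p
  show thesis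
  proof
    show "c \<in> words (points m S)" by (simp add: words_def c_def)
    fix K assume K: "K \<in> Delta m s"
    have "evword m S K q = (\<Sum>p\<in>points m S. evalmon m K p * e p q)" for q
    proof -
      have "(\<Sum>p\<in>points m S. evalmon m K p * e p q)
          = (\<Sum>p\<in>points m S. if q = p then evalmon m K p else 0)"
        by (intro sum.cong) (auto simp: e_def)
      then show ?thesis by (simp add: evword_def finite_points)
    qed
    then have "evword m S K = (\<Sum>p\<in>points m S. wscale (evalmon m K p) (e p))"
      by (simp add: fun_eq_iff sum_fun_apply wscale_def)
    then have "g (evword m S K) = (\<Sum>p\<in>points m S. evalmon m K p * g (e p))"
      by (simp add: pair.linear_sum[OF g(1)] pair.linear_scale[OF g(1)])
    also have "\<dots> = (\<Sum>p\<in>points m S. c p * evalmon m K p)"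
      by (intro sum.cong) (auto simp: c_def)
    finally have "(\<Sum>p\<in>points m S. c p * evalmon m K p) = g (evword m S K)" ..
    also have "\<dots> = (if evword m S K = evword m S N then 1 else 0)" using g(2) K by blast
    also have "\<dots> = (if K = N then 1 else 0)"
      using inj_on_eq_iff[OF inj_on_evword[OF assms(1)] K assms(2)] by simp
    finally show "(\<Sum>p\<in>points m S. c p * evalmon m K p) = (if K = N then 1 else 0)" .
  qed
qed

section \<open>Relative minimum weights and the assembly of the bounds\<close>

lemma M1_geI:
  assumes "finite P" "C1 - C2 \<noteq> {}" "\<And>c. c \<in> C1 - C2 \<Longrightarrow> d \<le> hweight P c"
  shows "d \<le> M1 P C1 C2"
proof -
  have "hweight P ` (C1 - C2) \<subseteq> {..card P}"
    using assms(1) by (auto simp: hweight_def intro: card_mono)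
  then have "finite (hweight P ` (C1 - C2))" by (rule finite_subset) simp
  then show ?thesis unfolding M1_def using assms by (subst Min_ge_iff) auto
qed

theorem mainTheorem4:
  fixes m s v \<delta> \<delta>p :: nat
    and S :: "nat \<Rightarrow> 'a::{finite,field} set"
  assumes hm: "m \<ge> 2"
    and hs: "2 \<le> s" "s \<le> CARD('a)"
    and hS: "\<forall>t<m. card (S t) = s"
    and hdelta: "1 \<le> \<delta>" "\<delta> \<le> s ^ m"
    and hv: "v \<le> m - 1" "s ^ v \<le> \<delta>" "\<delta> \<le> s ^ (v + 1)"
    and hdp: "1 \<le> \<delta>p"
      "real \<delta>p \<le> real_of_int \<lfloor>(real s - real \<delta> / real s ^ v + 1) * real s ^ (m - v - 1)\<rfloor>"
  defines "L1 \<equiv> {N \<in> Delta m s. Dfun m s N \<ge> \<delta>}"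
    and "L2 \<equiv> {N \<in> Delta m s. Dperp m N < \<delta>p}"
    and "P \<equiv> points m S"
  shows "L2 \<subseteq> L1
    \<and> int (card L1) - int (card L2) = int (wdim (evcode m S L1)) - int (wdim (evcode m S L2))
    \<and> real (card L1) - real (card L2) \<ge> real s ^ m
        - (\<Sum>t=1..m. (1 / fact (t - 1)) *
             (real \<delta> * (ln (real s ^ m / real \<delta>)) ^ (t - 1)
              + real \<delta>p * (ln (real s ^ m / real \<delta>p)) ^ (t - 1)))
    \<and> (card L1 - card L2 \<ge> 1 \<longrightarrow>
         M1 P (evcode m S L1) (evcode m S L2) \<ge> \<delta>
       \<and> M1 P (dualcode P (evcode m S L2)) (dualcode P (evcode m S L1)) \<ge> \<delta>p)"
proof (intro conjI impI)
  have fin: "finite L1" "finite L2" "finite P" and sub: "L1 \<subseteq> Delta m s" "L2 \<subseteq> Delta m s"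
    using finite_Delta finite_points by (auto simp: L1_def L2_def P_def)
  have s: "0 < s" "1 \<le> s" using hs by simp_all
  have m: "0 < m" using hm by simp
  have v: "v < m" using hv(1) m by simp

  have dp: "real \<delta>p \<le> (real s - real \<delta> / real s ^ v + 1) * real s ^ (m - v - 1)"
    using hdp(2) of_int_floor_le order_trans by blast
  show L21: "L2 \<subseteq> L1"
  proof
    fix N assume N: "N \<in> L2"
    have "\<not> Dfun m s N < \<delta>"
    proof
      assume "Dfun m s N < \<delta>"
      then have "real \<delta>p \<le> real (Dperp m N)"
        using Dperp_ge_of_Dfun_less[OF _ s(2) v hv(2,3)] N sub dp by fastforce
      then show False using N by (simp add: L2_def)
    qed
    then show "N \<in> L1" using N by (simp add: L1_def L2_def)
  qed

  show "int (card L1) - int (card L2) = int (wdim (evcode m S L1)) - int (wdim (evcode m S L2))"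
    by (simp add: wdim_evcode[OF hS] sub)

  \<comment> \<open>Required by the count for \<open>L2\<close>; since
    \<open>s ^ v \<le> \<delta>\<close>, the bound on \<open>\<delta>p\<close> is at most
    \<open>s ^ (m - v)\<close>.\<close>
  have "\<delta>p \<le> s ^ m"
  proof -
    have "real (s ^ v) \<le> real \<delta>" using hv(2) by (simp only: of_nat_le_iff)
    then have "1 \<le> real \<delta> / real s ^ v" using s by simp
    then have "(real s - real \<delta> / real s ^ v + 1) * real s ^ (m - v - 1)
        \<le> real s * real s ^ (m - v - 1)"
      by (intro mult_right_mono) auto
    also have "\<dots> = real s ^ Suc (m - v - 1)" by simp
    also have "\<dots> \<le> real s ^ m" using s v by (intro power_increasing) auto
    finally have "real \<delta>p \<le> real s ^ m" by (rule order_trans[OF dp])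
    then show ?thesis by (simp only: of_nat_le_iff flip: of_nat_power)
  qed
  have "card L1 = s ^ m - card {N \<in> Delta m s. (\<Prod>t<m. s - N t) < \<delta>}"
  proof -
    have "L1 = Delta m s - {N \<in> Delta m s. (\<Prod>t<m. s - N t) < \<delta>}"
      by (auto simp: L1_def Dfun_def)
    then show ?thesis by (simp add: card_Diff_subset finite_Delta card_Delta)
  qed
  \<comment> \<open>The truncated subtraction becomes an addition before the cast to reals.\<close>
  then have "s ^ m \<le> card L1 + card {N \<in> Delta m s. (\<Prod>t<m. s - N t) < \<delta>}" by linarith
  then have "real s ^ m \<le> real (card L1) + real (card {N \<in> Delta m s. (\<Prod>t<m. s - N t) < \<delta>})"
    by (simp only: of_nat_le_iff flip: of_nat_power of_nat_add)
  moreover have "real (card {N \<in> Delta m s. (\<Prod>t<m. s - N t) < \<delta>})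
      \<le> (\<Sum>t=1..m. (1 / fact (t - 1)) * (real \<delta> * ln (real s ^ m / real \<delta>) ^ (t - 1)))"
  proof (rule card_prod_less_le)
    show "bij_betw (\<lambda>i. s - i) {..<s} {1..s}"
      by (rule bij_betw_byWitness[where f' = "\<lambda>i. s - i"]) auto
  qed (use s m hdelta in auto)
  moreover have "real (card L2)
      \<le> (\<Sum>t=1..m. (1 / fact (t - 1)) * (real \<delta>p * ln (real s ^ m / real \<delta>p) ^ (t - 1)))"
    unfolding L2_def Dperp_def
  proof (rule card_prod_less_le)
    show "bij_betw (\<lambda>i. i + 1) {..<s} {1..s}"
      by (rule bij_betw_byWitness[where f' = "\<lambda>i. i - 1"]) auto
  qed (use s m hdp \<open>\<delta>p \<le> s ^ m\<close> in auto)
  ultimately show "real (card L1) - real (card L2) \<ge> real s ^ m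
        - (\<Sum>t=1..m. (1 / fact (t - 1)) *
             (real \<delta> * (ln (real s ^ m / real \<delta>)) ^ (t - 1)
              + real \<delta>p * (ln (real s ^ m / real \<delta>p)) ^ (t - 1)))"
    by (simp only: distrib_left sum.distrib)

  assume "card L1 - card L2 \<ge> 1"
  then have "\<not> L1 \<subseteq> L2" using card_mono[OF fin(2)] by fastforce
  then obtain N where N: "N \<in> L1" "N \<notin> L2" by blast
  \<comment> \<open>This \<open>c\<close> is orthogonal to \<open>L2\<close> but not to
    \<open>N\<close>. It shows both differences of codes nonempty, without which the
    \<open>Min\<close> in \<open>M1\<close> says nothing.\<close>
  obtain c where c: "c \<in> words P"
    "\<And>K. K \<in> Delta m s \<Longrightarrow> (\<Sum>p\<in>P. c p * evalmon m K p) = (if K = N then 1 else 0)"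
    using exists_dual_word[OF hS, of N] N(1) sub(1) unfolding P_def by blast
  note dual_iff = dualcode_evcode_iff[where m = m and S = S, folded P_def]
  have "(\<Sum>p\<in>P. c p * evalmon m K p) = 0" if "K \<in> L2" for K
    using c(2)[of K] that N(2) sub(2) by auto
  moreover have "(\<Sum>p\<in>P. c p * evalmon m N p) \<noteq> 0"
    using c(2)[of N] N(1) sub(1) by auto
  ultimately have c_dual: "c \<in> dualcode P (evcode m S L2) - dualcode P (evcode m S L1)"
    using c(1) N(1) by (auto simp: dual_iff fin)

  have "evcode m S L1 \<noteq> evcode m S L2" using c_dual by auto
  moreover have "evcode m S L2 \<subseteq> evcode m S L1"
    using L21 by (simp add: evcode_eq_span[OF hS] sub word_space.span_mono image_mono)
  ultimately have "evcode m S L1 - evcode m S L2 \<noteq> {}" by blast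
  then show "\<delta> \<le> M1 P (evcode m S L1) (evcode m S L2)"
  proof (rule M1_geI[OF fin(3)])
    fix c assume c: "c \<in> evcode m S L1 - evcode m S L2"
    then obtain a where a: "c = (\<Sum>N\<in>L1. wscale (a N) (evword m S N))"
      unfolding evcode_eq by blast
    \<comment> \<open>The zero word lies in the smaller code, so \<open>c\<close> is
      nonzero.\<close>
    have "\<exists>N\<in>L1. a N \<noteq> 0"
    proof (rule ccontr)
      assume "\<not> ?thesis"
      then have "c = 0" unfolding a by (intro sum.neutral) (simp add: word_space.scale_zero_left)
      then show False using c word_space.span_zero evcode_eq_span[OF hS sub(2)] by auto
    qed
    then show "\<delta> \<le> hweight P c"
      using evcode_weight[OF hS sub(1)] unfolding a P_def L1_def by fastforce
  qed

  have "dualcode P (evcode m S L2) - dualcode P (evcode m S L1) \<noteq> {}" using c_dual by blast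
  then show "\<delta>p \<le> M1 P (dualcode P (evcode m S L2)) (dualcode P (evcode m S L1))"
  proof (rule M1_geI[OF fin(3)])
    fix c assume c: "c \<in> dualcode P (evcode m S L2) - dualcode P (evcode m S L1)"
    then have c2: "\<forall>N\<in>L2. (\<Sum>p\<in>P. c p * evalmon m N p) = 0"
      and "\<not> (\<forall>N\<in>L1. (\<Sum>p\<in>P. c p * evalmon m N p) = 0)"
      by (auto simp: dual_iff fin)
    \<comment> \<open>A word not orthogonal to \<open>L1\<close> is nonzero, so
      \<open>dual_weight\<close> applies; orthogonality to \<open>L2\<close> then forces
      \<open>Dperp m N \<ge> \<delta>p\<close>.\<close>
    then have "\<exists>p\<in>P. c p \<noteq> 0" by force
    then obtain N where "N \<in> Delta m s" "(\<Sum>p\<in>P. c p * evalmon m N p) \<noteq> 0"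
      "Dperp m N \<le> hweight P c"
      using dual_weight[OF hS, folded P_def] by blast
    then show "\<delta>p \<le> hweight P c" using c2 by (force simp: L2_def)
  qed
qed

end
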